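(* Let $S\subset\mathbb{R}^{2,1}$ be a regular surface and let $q\in\mathbb{R}^{2,1}\setminus S$. Let $S_q=I_q(S)$, where $I_q(p)=\frac{p-q}{\langle p-q,p-q\rangle}$ is the inversion with respect to the point $q$. Then the principal lines on $S$ are the same as those on $S_q$, in the sense that they correspond under $I_q$: a curve $\gamma$ in $S$ is a principal line of $S$ if and only if $I_q\circ\gamma$ is a principal line of $S_q$.
   Context: The Minkowski 3-space $\mathbb{R}^{2,1}$ is $\mathbb{R}^3$ with the inner product $\langle p,q\rangle=p_1q_1+p_2q_2-p_3q_3$; the vector product is characterized by $\langle p\times q,r\rangle=\det(p,q,r)$ for all $r$; $\|p\|=\sqrt{|\langle p,p\rangle|}$. For a local parametrization $X(u,v)$ of a smooth surface, put $E=\langle X_u,X_u\rangle$, $F=\langle X_u,X_v\rangle$, $G=\langle X_v,X_v\rangle$. Where $EG-F^2\neq0$ let $N=\pm\frac{X_u\times X_v}{\|X_u\times X_v\|}$, $e=\langle X_{uu},N\rangle$, $f=\langle X_{uv},N\rangle$, $g=\langle X_{vv},N\rangle$. The equation of principal lines is $L_1\,dv^2+M_1\,du\,dv+N_1\,du^2=0$, with $L_1=\|X_u\times X_v\|(Fg-Gf)$, $M_1=\|X_u\times X_v\|(Eg-Ge)$, $N_1=\|X_u\times X_v\|(Ef-Fe)$. It extends to the points where $EG-F^2=0$ since, up to a common sign, $\|X_u\times X_v\|\,e$, $\|X_u\times X_v\|\,f$, $\|X_u\times X_v\|\,g$ equal $\langle X_{uu},X_u\times X_v\rangle$, $\langle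 X_{uv},X_u\times X_v\rangle$, $\langle X_{vv},X_u\times X_v\rangle$. Umbilic points are the points where $L_1=M_1=N_1=0$. A smooth curve is a principal line if it satisfies the equation of principal lines and there are no umbilic points on it.
   Formalization: Since I_q is undefined where ⟨p−q,p−q⟩=0, which q∉S does not exclude, S_q is taken as the image under I_q of the points of S off this light cone of q, and the curves γ are required to lie in that part of S. *)

theory Defs
  imports "HOL-Analysis.Analysis"
begin

section \<open>Minkowski 3-space\<close>

definition mink :: "real^3 \<Rightarrow> real^3 \<Rightarrow> real" where
  "mink p q = p$1 * q$1 + p$2 * q$2 - p$3 * q$3"

definition mnorm :: "real^3 \<Rightarrow> real" where
  "mnorm p = sqrt \<bar>mink p p\<bar>"

definition mcross :: "real^3 \<Rightarrow> real^3 \<Rightarrow> real^3" where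
  "mcross p q = (THE w. \<forall>r. mink w r = det (vector [p, q, r]))"

lemma mcross_eq:
  "mcross p q = vector [p$2 * q$3 - p$3 * q$2, p$3 * q$1 - p$1 * q$3, p$2 * q$1 - p$1 * q$2]"
  unfolding mcross_def
proof (rule the_equality)
  let ?c = "vector [p$2 * q$3 - p$3 * q$2, p$3 * q$1 - p$1 * q$3, p$2 * q$1 - p$1 * q$2] :: real^3"
  show *: "\<forall>r. mink ?c r = det (vector [p, q, r])"
    by (simp add: mink_def det_3 algebra_simps)
  fix w assume "\<forall>r. mink w r = det (vector [p, q, r])"
  with * have eq: "mink w r = mink ?c r" for r by simp
  have "w$1 = ?c$1" "w$2 = ?c$2" "w$3 = ?c$3"
    using eq[of "vector [1,0,0]"] eq[of "vector [0,1,0]"] eq[of "vector [0,0,1]"]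
    by (simp_all add: mink_def)
  then show "w = ?c" by (simp add: vec_eq_iff forall_3)
qed

lemma mink_mcross: "mink (mcross p q) r = det (vector [p, q, r])"
  by (simp add: mcross_eq mink_def det_3 algebra_simps)

lemma mink_mcross_self:
  "mink (mcross p q) (mcross p q) = - (mink p p * mink q q - (mink p q)\<^sup>2)"
  by (simp add: mcross_eq mink_def power2_eq_square algebra_simps)

text \<open>The points at which the inversion with respect to \<open>q\<close> is undefined; \<open>q\<close> is one of them.\<close>

definition light_cone :: "real^3 \<Rightarrow> (real^3) set" where
  "light_cone q = {p. mink (p - q) (p - q) = 0}"

definition minversion :: "real^3 \<Rightarrow> real^3 \<Rightarrow> real^3" where
  "minversion q p = (1 / mink (p - q) (p - q)) *\<^sub>R (p - q)"

section \<open>Smooth maps, curves and surfaces\<close>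

text \<open>\<open>C\<^sup>k\<close> and \<open>C\<^sup>\<infinity>\<close> maps; the domain \<open>U\<close> is meant to be open.\<close>

primrec Ck_on :: "nat \<Rightarrow> ('a::euclidean_space \<Rightarrow> 'b::euclidean_space) \<Rightarrow> 'a set \<Rightarrow> bool" where
  "Ck_on 0 f U \<longleftrightarrow> continuous_on U f"
| "Ck_on (Suc k) f U \<longleftrightarrow> (\<forall>x\<in>U. f differentiable (at x)) \<and>
     (\<forall>w. Ck_on k (\<lambda>x. frechet_derivative f (at x) w) U)"

definition smooth_on :: "'a::euclidean_space set \<Rightarrow> ('a \<Rightarrow> 'b::euclidean_space) \<Rightarrow> bool" where
  "smooth_on U f \<longleftrightarrow> (\<forall>k. Ck_on k f U)"

definition smooth_curve :: "real set \<Rightarrow> (real \<Rightarrow> real^3) \<Rightarrow> bool" where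
  "smooth_curve J \<gamma> \<longleftrightarrow> open J \<and> is_interval J \<and> J \<noteq> {} \<and> smooth_on J \<gamma> \<and>
     (\<forall>t\<in>J. vector_derivative \<gamma> (at t) \<noteq> 0)"

definition local_parametrization ::
    "(real^3) set \<Rightarrow> (real \<times> real) set \<Rightarrow> (real \<times> real \<Rightarrow> real^3) \<Rightarrow> bool" where
  "local_parametrization S U X \<longleftrightarrow>
     open U \<and> smooth_on U X \<and> openin (top_of_set S) (X ` U) \<and>
     (\<exists>Y. homeomorphism U (X ` U) X Y) \<and>
     (\<forall>z\<in>U. inj (frechet_derivative X (at z)))"

definition regular_surface :: "(real^3) set \<Rightarrow> bool" where
  "regular_surface S \<longleftrightarrow> (\<forall>p\<in>S. \<exists>U X. local_parametrization S U X \<and> p \<in> X ` U)"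

section \<open>Fundamental forms\<close>

definition d_u :: "(real \<times> real \<Rightarrow> real^3) \<Rightarrow> real \<times> real \<Rightarrow> real^3" where
  "d_u X z = frechet_derivative X (at z) (1, 0)"

definition d_v :: "(real \<times> real \<Rightarrow> real^3) \<Rightarrow> real \<times> real \<Rightarrow> real^3" where
  "d_v X z = frechet_derivative X (at z) (0, 1)"

definition ff_E :: "(real \<times> real \<Rightarrow> real^3) \<Rightarrow> real \<times> real \<Rightarrow> real" where
  "ff_E X z = mink (d_u X z) (d_u X z)"

definition ff_F :: "(real \<times> real \<Rightarrow> real^3) \<Rightarrow> real \<times> real \<Rightarrow> real" where
  "ff_F X z = mink (d_u X z) (d_v X z)"

definition ff_G :: "(real \<times> real \<Rightarrow> real^3) \<Rightarrow> real \<times> real \<Rightarrow> real" where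
  "ff_G X z = mink (d_v X z) (d_v X z)"

definition normal_field :: "(real \<times> real \<Rightarrow> real^3) \<Rightarrow> real \<times> real \<Rightarrow> real^3" where
  "normal_field X z = mcross (d_u X z) (d_v X z)"

definition unit_normal :: "(real \<times> real \<Rightarrow> real^3) \<Rightarrow> real \<times> real \<Rightarrow> real^3" where
  "unit_normal X z = (1 / mnorm (normal_field X z)) *\<^sub>R normal_field X z"

text \<open>The second fundamental form for a given choice \<open>N\<close> of normal vector.\<close>

definition sf_e :: "(real \<times> real \<Rightarrow> real^3) \<Rightarrow> real^3 \<Rightarrow> real \<times> real \<Rightarrow> real" where
  "sf_e X N z = mink (d_u (d_u X) z) N"

definition sf_f :: "(real \<times> real \<Rightarrow> real^3) \<Rightarrow> real^3 \<Rightarrow> real \<times> real \<Rightarrow> real" where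
  "sf_f X N z = mink (d_v (d_u X) z) N"

definition sf_g :: "(real \<times> real \<Rightarrow> real^3) \<Rightarrow> real^3 \<Rightarrow> real \<times> real \<Rightarrow> real" where
  "sf_g X N z = mink (d_v (d_v X) z) N"

section \<open>Principal lines\<close>

text \<open>The coefficients of \<open>L\<^sub>1 dv\<^sup>2 + M\<^sub>1 du dv + N\<^sub>1 du\<^sup>2 = 0\<close> in the form that also makes sense where
  \<open>EG - F\<^sup>2 = 0\<close>, that is, with \<open>\<langle>X\<^sub>u\<^sub>u, X\<^sub>u \<times> X\<^sub>v\<rangle>\<close> etc. in place of \<open>\<parallel>X\<^sub>u \<times> X\<^sub>v\<parallel> e\<close> etc. The lemma
  \<open>coeffs_eq\<close> below is the comparison where \<open>EG - F\<^sup>2 \<noteq> 0\<close>.\<close>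

definition coeff_L :: "(real \<times> real \<Rightarrow> real^3) \<Rightarrow> real \<times> real \<Rightarrow> real" where
  "coeff_L X z = ff_F X z * sf_g X (normal_field X z) z - ff_G X z * sf_f X (normal_field X z) z"

definition coeff_M :: "(real \<times> real \<Rightarrow> real^3) \<Rightarrow> real \<times> real \<Rightarrow> real" where
  "coeff_M X z = ff_E X z * sf_g X (normal_field X z) z - ff_G X z * sf_e X (normal_field X z) z"

definition coeff_N :: "(real \<times> real \<Rightarrow> real^3) \<Rightarrow> real \<times> real \<Rightarrow> real" where
  "coeff_N X z = ff_E X z * sf_f X (normal_field X z) z - ff_F X z * sf_e X (normal_field X z) z"

lemma coeffs_eq:
  fixes X z \<epsilon>
  defines "n \<equiv> mnorm (normal_field X z)" and "N \<equiv> \<epsilon> *\<^sub>R unit_normal X z"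
  assumes nz: "ff_E X z * ff_G X z - (ff_F X z)\<^sup>2 \<noteq> 0" and sign: "\<epsilon> = 1 \<or> \<epsilon> = -1"
  shows "n * (ff_F X z * sf_g X N z - ff_G X z * sf_f X N z) = \<epsilon> * coeff_L X z"
    and "n * (ff_E X z * sf_g X N z - ff_G X z * sf_e X N z) = \<epsilon> * coeff_M X z"
    and "n * (ff_E X z * sf_f X N z - ff_F X z * sf_e X N z) = \<epsilon> * coeff_N X z"
proof -
  have "n \<noteq> 0"
    using nz unfolding n_def mnorm_def normal_field_def mink_mcross_self ff_E_def ff_F_def ff_G_def
    by simp
  moreover have "mink a N = \<epsilon> * (1 / n) * mink a (normal_field X z)" for a
    by (simp add: N_def n_def unit_normal_def mink_def algebra_simps)
  ultimately have "n * mink a N = \<epsilon> * mink a (normal_field X z)" for a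
    by simp
  then have *: "n * (x * mink a N - y * mink b N) =
      \<epsilon> * (x * mink a (normal_field X z) - y * mink b (normal_field X z))" for a b x y
    by (simp only: right_diff_distrib mult.left_commute[of n] mult.left_commute[of \<epsilon>])
  show "n * (ff_F X z * sf_g X N z - ff_G X z * sf_f X N z) = \<epsilon> * coeff_L X z"
      "n * (ff_E X z * sf_g X N z - ff_G X z * sf_e X N z) = \<epsilon> * coeff_M X z"
      "n * (ff_E X z * sf_f X N z - ff_F X z * sf_e X N z) = \<epsilon> * coeff_N X z"
    unfolding coeff_L_def coeff_M_def coeff_N_def sf_e_def sf_f_def sf_g_def by (rule *)+
qed

definition umbilic :: "(real \<times> real \<Rightarrow> real^3) \<Rightarrow> real \<times> real \<Rightarrow> bool" where
  "umbilic X z \<longleftrightarrow> coeff_L X z = 0 \<and> coeff_M X z = 0 \<and> coeff_N X z = 0"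

definition principal_equation ::
    "(real \<times> real \<Rightarrow> real^3) \<Rightarrow> real \<times> real \<Rightarrow> real \<times> real \<Rightarrow> bool" where
  "principal_equation X z w \<longleftrightarrow>
     (case w of (du, dv) \<Rightarrow> coeff_L X z * dv\<^sup>2 + coeff_M X z * du * dv + coeff_N X z * du\<^sup>2 = 0)"

text \<open>The curve is expressed in the coordinates of a local parametrization as
  \<open>(u(t), v(t)) = X\<^sup>-\<^sup>1 (\<gamma> t)\<close>, which is defined for all \<open>s\<close> near \<open>t\<close> when \<open>\<gamma> t \<in> X ` U\<close>.\<close>

definition principal_line :: "(real^3) set \<Rightarrow> real set \<Rightarrow> (real \<Rightarrow> real^3) \<Rightarrow> bool" where
  "principal_line S J \<gamma> \<longleftrightarrow>
     smooth_curve J \<gamma> \<and> \<gamma> ` J \<subseteq> S \<and>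
     (\<forall>U X. local_parametrization S U X \<longrightarrow>
       (\<forall>t\<in>J. \<gamma> t \<in> X ` U \<longrightarrow>
          principal_equation X (inv_into U X (\<gamma> t))
            (vector_derivative (\<lambda>s. inv_into U X (\<gamma> s)) (at t)) \<and>
          \<not> umbilic X (inv_into U X (\<gamma> t))))"

end

theory Submission
  imports Defs
begin

text \<open>
  Inversion is conformal for the Minkowski product. With \<open>p = X - q\<close> and \<open>a = \<langle>p, p\<rangle>\<close>, its differential
  at \<open>X\<close> is \<open>1/a\<close> times the reflection in the plane orthogonal to \<open>p\<close>
  (\<open>has_derivative_minv\<close>). The reflection is a linear isometry of determinant \<open>-1\<close>, so \<open>E\<close>, \<open>F\<close>, \<open>G\<close>
  are all divided by \<open>a\<^sup>2\<close>, and the normal \<open>n = X\<^sub>u \<times> X\<^sub>v\<close> goes to \<open>-1/a\<^sup>2\<close> times its reflection.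

  The second derivatives of the inverted parametrization are the reflected second derivatives of \<open>X\<close>
  divided by \<open>a\<close>, plus the Hessian of the inversion applied to the first derivatives. Paired with
  the reflection of a vector normal to the surface, this Hessian is a multiple of the first fundamental form
  (\<open>mink_inversion_d2_mreflect\<close>). Hence the second fundamental form is multiplied by
  \<open>-1/a\<^sup>3\<close> and then changed by a multiple of the first. Since \<open>L\<^sub>1\<close>, \<open>M\<^sub>1\<close>, \<open>N\<^sub>1\<close> are the
  \<open>2 \<times> 2\<close> minors of the matrix of both forms, that change cancels, and all three are multiplied by
  \<open>-1/a\<^sup>5\<close> (\<open>coeffs_minv\<close>). So the equation of principal lines and the umbilic
  points are the same in corresponding parametrizations. No unit normal occurs in the argument, so it covers
  the points where \<open>EG - F\<^sup>2 = 0\<close> as well.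

  What remains is that parametrizations and curves do correspond. Inversion is a diffeomorphism
  between the complements of two light cones, and the condition on a curve at a point involves the
  parametrization only near that point, so parametrizations may be restricted to the open part of the
  surface off the light cone (\<open>principal_line_minv\<close>). The inverse of an inversion is again
  an inversion followed by a translation, so one direction of the equivalence, stated for such
  compositions, gives the other.
\<close>

section \<open>Closure properties of smooth maps\<close>

text \<open>A derivative at a point of the domain depends on the values nearby, and openness keeps these
  inside the domain.\<close>

lemma Ck_on_cong:
  assumes "Ck_on k f U" "open U" "\<And>x. x \<in> U \<Longrightarrow> f x = g x"
  shows "Ck_on k g U"
  using assms
proof (induction k arbitrary: f g)
  case 0
  then show ?case by (simp cong: continuous_on_cong)
next
  case (Suc k)
  have der: "(g has_derivative frechet_derivative f (at x)) (at x)" if "x \<in> U" for x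
  proof (rule has_derivative_transform_within_open[OF _ Suc.prems(2) that Suc.prems(3)])
    show "(f has_derivative frechet_derivative f (at x)) (at x)"
      using Suc.prems(1) that by (simp add: frechet_derivative_works[symmetric])
  qed
  have "Ck_on k (\<lambda>x. frechet_derivative g (at x) w) U" for w
  proof (rule Suc.IH[OF _ Suc.prems(2)])
    show "Ck_on k (\<lambda>x. frechet_derivative f (at x) w) U"
      using Suc.prems(1) by simp
  qed (metis der frechet_derivative_at)
  then show ?case
    using der by (auto simp: differentiable_def)
qed

lemma Ck_on_SucI:
  assumes "open U" "\<And>x. x \<in> U \<Longrightarrow> (f has_derivative f' x) (at x)"
    and "\<And>w. Ck_on k (\<lambda>x. f' x w) U"
  shows "Ck_on (Suc k) f U"
proof -
  have "Ck_on k (\<lambda>x. frechet_derivative f (at x) w) U" for w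
    by (rule Ck_on_cong[OF assms(3)[of w] assms(1)]) (metis assms(2) frechet_derivative_at)
  then show ?thesis
    using assms(2) by (auto simp: differentiable_def)
qed

lemma Ck_on_SucD:
  assumes "Ck_on (Suc k) f U"
  shows "\<And>x. x \<in> U \<Longrightarrow> (f has_derivative frechet_derivative f (at x)) (at x)"
    and "\<And>w. Ck_on k (\<lambda>x. frechet_derivative f (at x) w) U"
  using assms by (simp_all add: frechet_derivative_works[symmetric])

lemma Ck_on_Suc_imp_Ck_on: "Ck_on (Suc k) f U \<Longrightarrow> Ck_on k f U"
proof (induction k arbitrary: f)
  case 0
  then show ?case
    by (auto intro!: continuous_at_imp_continuous_on differentiable_imp_continuous_within)
qed simp

lemma Ck_on_const: "Ck_on k (\<lambda>x. c) U"
proof (induction k arbitrary: c)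
  case (Suc k)
  then show ?case by (simp add: frechet_derivative_const)
qed simp

lemma Ck_on_add:
  assumes "open U" "Ck_on k f U" "Ck_on k g U"
  shows "Ck_on k (\<lambda>x. f x + g x) U"
  using assms(2,3)
proof (induction k arbitrary: f g)
  case 0
  then show ?case by (simp add: continuous_on_add)
next
  case (Suc k)
  show ?case
    by (rule Ck_on_SucI[OF assms(1) has_derivative_add])
       (use Suc.prems in \<open>auto intro!: Ck_on_SucD Suc.IH\<close>)
qed

text \<open>By the product rule each derivative is a sum of two products of the same kind, one of
  whose factors has lost an order of differentiability.\<close>

lemma Ck_on_bilinear:
  assumes "bounded_bilinear B" "open U" "Ck_on k f U" "Ck_on k g U"
  shows "Ck_on k (\<lambda>x. B (f x) (g x)) U"
  using assms(3,4)
proof (induction k arbitrary: f g)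
  case 0
  then show ?case by (simp add: bounded_bilinear.continuous_on[OF assms(1)])
next
  case (Suc k)
  show ?case
    by (rule Ck_on_SucI[OF assms(2) bounded_bilinear.FDERIV[OF assms(1)]])
       (use Suc.prems in \<open>auto intro!: Ck_on_SucD Ck_on_add[OF assms(2)] Suc.IH
          intro: Ck_on_Suc_imp_Ck_on\<close>)
qed

text \<open>Since \<open>(1/f)' = -f'/f\<^sup>2\<close>, the derivative contains no inverse other than that of \<open>f\<close>, to which the
  induction hypothesis applies.\<close>

lemma Ck_on_inverse:
  fixes f :: "'a::euclidean_space \<Rightarrow> real"
  assumes "open U" "Ck_on k f U" "\<And>x. x \<in> U \<Longrightarrow> f x \<noteq> 0"
  shows "Ck_on k (\<lambda>x. inverse (f x)) U"
  using assms(2)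
proof (induction k)
  case 0
  then show ?case using assms(3) by (auto intro!: continuous_on_inverse)
next
  case (Suc k)
  note mult = Ck_on_bilinear[OF bounded_bilinear_mult assms(1)]
  show ?case
  proof (rule Ck_on_SucI[OF assms(1)])
    show "((\<lambda>x. inverse (f x)) has_derivative
        (\<lambda>h. (- 1) * (inverse (f x) * frechet_derivative f (at x) h * inverse (f x)))) (at x)"
      if "x \<in> U" for x
      using Deriv.has_derivative_inverse[OF assms(3)[OF that] Ck_on_SucD(1)[OF Suc.prems that]] by simp
    have "Ck_on k (\<lambda>x. inverse (f x)) U"
      using Suc by (blast intro: Ck_on_Suc_imp_Ck_on)
    then show "Ck_on k (\<lambda>x. (- 1) * (inverse (f x) * frechet_derivative f (at x) w * inverse (f x))) U"
      for w
      using Ck_on_SucD(2)[OF Suc.prems] by (intro mult Ck_on_const)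
  qed
qed

section \<open>The Minkowski product and reflections\<close>

lemma bounded_bilinear_mink: "bounded_bilinear mink"
  unfolding bilinear_conv_bounded_bilinear[symmetric]
  by (auto simp: bilinear_def linear_iff mink_def algebra_simps)

lemma mink_commute: "mink x y = mink y x"
  by (simp add: mink_def mult.commute)

lemmas mink_simps =
  bounded_bilinear.add_left[OF bounded_bilinear_mink]
  bounded_bilinear.add_right[OF bounded_bilinear_mink]
  bounded_bilinear.diff_left[OF bounded_bilinear_mink]
  bounded_bilinear.diff_right[OF bounded_bilinear_mink]
  bounded_bilinear.scaleR_left[OF bounded_bilinear_mink]
  bounded_bilinear.scaleR_right[OF bounded_bilinear_mink]

lemma mink_mcross_left [simp]: "mink p (mcross p r) = 0" "mink r (mcross p r) = 0"
  by (simp_all add: mcross_eq mink_def algebra_simps)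

definition mreflect :: "real^3 \<Rightarrow> real^3 \<Rightarrow> real^3" where
  "mreflect p h = h - (2 * mink p h / mink p p) *\<^sub>R p"

lemma mink_mreflect_self:
  assumes "mink p p \<noteq> 0"
  shows "mink p (mreflect p h) = - mink p h"
proof -
  have "mink p (mreflect p h) = mink p h - (2 * mink p h / mink p p) * mink p p"
    unfolding mreflect_def mink_simps real_scaleR_def ..
  also have "(2 * mink p h / mink p p) * mink p p = 2 * mink p h"
    using assms by (rule nonzero_eq_divide_eq[THEN iffD1]) (rule refl)
  finally show ?thesis by simp
qed

lemma mreflect_mreflect:
  assumes "mink p p \<noteq> 0"
  shows "mreflect p (mreflect p h) = h"
proof -
  have "mreflect p (mreflect p h) = mreflect p h + (2 * mink p h / mink p p) *\<^sub>R p"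
    unfolding mreflect_def[of p "mreflect p h"] mink_mreflect_self[OF assms] by simp
  then show ?thesis
    unfolding mreflect_def[of p h] by simp
qed

lemma mink_mreflect:
  assumes "mink p p \<noteq> 0"
  shows "mink (mreflect p h) (mreflect p k) = mink h k"
proof -
  have "mink (mreflect p h) (mreflect p k)
      = mink h (mreflect p k) - 2 * mink p h / mink p p * mink p (mreflect p k)"
    unfolding mreflect_def[of p h] mink_simps real_scaleR_def ..
  also have "mink h (mreflect p k) = mink h k - 2 * mink p k / mink p p * mink p h"
    unfolding mreflect_def mink_simps real_scaleR_def mink_commute[of h p] ..
  finally show ?thesis
    unfolding mink_mreflect_self[OF assms] by simp
qed

text \<open>The sign is the determinant of the reflection: an isometry \<open>R\<close> satisfies
  \<open>R h \<times> R k = det R \<cdot> R (h \<times> k)\<close>.\<close>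

lemma mcross_mreflect:
  assumes "mink p p \<noteq> 0"
  shows "mcross (mreflect p h) (mreflect p k) = - mreflect p (mcross h k)"
proof -
  define s where "s = 2 * mink p h / mink p p"
  define t where "t = 2 * mink p k / mink p p"
  define r where "r = 2 * mink p (mcross h k) / mink p p"
  \<comment> \<open>The dual basis expansion
    \<open>det(h, k, p) w = \<langle>w, h\<rangle> (k \<times> p) + \<langle>w, k\<rangle> (p \<times> h) + \<langle>w, p\<rangle> (h \<times> k)\<close> at \<open>w = p\<close>.\<close>
  have "mink p p *\<^sub>R mcross h k
      = mink p k *\<^sub>R mcross h p + mink p h *\<^sub>R mcross p k + mink p (mcross h k) *\<^sub>R p"
    by (simp add: mcross_eq mink_def vec_eq_iff forall_3 algebra_simps)
  then have "(2 / mink p p) *\<^sub>R (mink p p *\<^sub>R mcross h k) = (2 / mink p p) *\<^sub>R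
      (mink p k *\<^sub>R mcross h p + mink p h *\<^sub>R mcross p k + mink p (mcross h k) *\<^sub>R p)"
    by simp
  then have "2 *\<^sub>R mcross h k = t *\<^sub>R mcross h p + s *\<^sub>R mcross p k + r *\<^sub>R p"
    using assms by (simp add: s_def t_def r_def scaleR_add_right)
  moreover have "mcross (h - s *\<^sub>R p) (k - t *\<^sub>R p)
      = mcross h k - (t *\<^sub>R mcross h p + s *\<^sub>R mcross p k)"
    by (simp add: mcross_eq vec_eq_iff forall_3 algebra_simps)
  ultimately have "mcross (h - s *\<^sub>R p) (k - t *\<^sub>R p) = - (mcross h k - r *\<^sub>R p)"
    by (simp add: scaleR_2)
  then show ?thesis
    unfolding mreflect_def s_def[symmetric] t_def[symmetric] r_def[symmetric] .
qed

lemma mcross_scaleR: "mcross (c *\<^sub>R h) (d *\<^sub>R k) = (c * d) *\<^sub>R mcross h k"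
  by (simp add: mcross_eq vec_eq_iff forall_3 algebra_simps)

text \<open>The second derivative at \<open>p\<close>, in the directions \<open>h\<close> and \<open>k\<close>, of the map \<open>p \<mapsto> p / \<langle>p, p\<rangle>\<close>.\<close>

definition inversion_d2 :: "real^3 \<Rightarrow> real^3 \<Rightarrow> real^3 \<Rightarrow> real^3" where
  "inversion_d2 p h k =
     (8 * mink p h * mink p k / mink p p ^ 3) *\<^sub>R p
     - (2 / (mink p p)\<^sup>2) *\<^sub>R (mink p k *\<^sub>R h + mink p h *\<^sub>R k + mink h k *\<^sub>R p)"

text \<open>The terms of the Hessian in the directions \<open>h\<close> and \<open>k\<close> are seen by the reflected normal only
  through its component along \<open>p\<close>, and that contribution cancels the cubic term. What survives
  is a multiple of \<open>\<langle>h, k\<rangle>\<close>.\<close>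

lemma mink_inversion_d2_mreflect:
  assumes "mink p p \<noteq> 0" "mink h n = 0" "mink k n = 0"
  shows "mink (inversion_d2 p h k) (mreflect p n) = 2 * mink p n / (mink p p)\<^sup>2 * mink h k"
proof -
  define a where "a = mink p p"
  define d where "d = inversion_d2 p h k"
  have a: "a \<noteq> 0"
    using assms(1) by (simp add: a_def)
  have dn: "mink d n = 8 * mink p h * mink p k / a ^ 3 * mink p n - 2 / a\<^sup>2 * (mink h k * mink p n)"
    unfolding d_def inversion_d2_def mink_simps assms(2,3) a_def[symmetric] by simp
  have dp: "mink d p = 4 * mink p h * mink p k / a\<^sup>2 - 2 * mink h k / a"
    unfolding d_def inversion_d2_def mink_simps a_def[symmetric] mink_commute[of h p]
      mink_commute[of k p]
    using a by (simp add: divide_simps) (simp add: algebra_simps eval_nat_numeral)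
  have "mink d (mreflect p n) = mink d n - 2 * mink p n / a * mink d p"
    unfolding mreflect_def mink_simps a_def real_scaleR_def ..
  also have "\<dots> = 2 * mink p n / a\<^sup>2 * mink h k"
    unfolding dn dp by (simp add: divide_inverse algebra_simps eval_nat_numeral)
  finally show ?thesis
    unfolding d_def a_def .
qed

section \<open>Inversion\<close>

text \<open>The inverse of \<open>minversion q\<close> is an inversion in the origin followed by the translation by \<open>q\<close>.
  Allowing a translation makes the family closed under inverses: \<open>minv q b\<close> and \<open>minv b q\<close> are
  mutually inverse off the light cones.\<close>

definition minv :: "real^3 \<Rightarrow> real^3 \<Rightarrow> real^3 \<Rightarrow> real^3" where
  "minv q b p = b + minversion q p"

lemma minv_0: "minv q 0 = minversion q"
  by (simp add: minv_def fun_eq_iff)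

lemma mink_minv_diff:
  "mink (minv q b p - b) (minv q b p - b) = 1 / mink (p - q) (p - q)"
proof -
  have "minv q b p - b = (1 / mink (p - q) (p - q)) *\<^sub>R (p - q)"
    by (simp add: minv_def minversion_def)
  then have "mink (minv q b p - b) (minv q b p - b)
      = 1 / mink (p - q) (p - q) * (1 / mink (p - q) (p - q) * mink (p - q) (p - q))"
    by (simp only: bounded_bilinear.scaleR_left[OF bounded_bilinear_mink]
        bounded_bilinear.scaleR_right[OF bounded_bilinear_mink] real_scaleR_def)
  then show ?thesis
    by simp
qed

lemma minv_notin_light_cone: "p \<notin> light_cone q \<Longrightarrow> minv q b p \<notin> light_cone b"
  by (simp add: light_cone_def mink_minv_diff)

lemma minv_minv: "p \<notin> light_cone q \<Longrightarrow> minv b q (minv q b p) = p"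
  unfolding minv_def[of b q] minversion_def[of b] mink_minv_diff
  by (simp add: light_cone_def minv_def minversion_def)

lemma open_light_cone_compl: "open (- light_cone q)"
proof -
  have "continuous_on UNIV (\<lambda>p. mink (p - q) (p - q))"
    by (intro bounded_bilinear.continuous_on[OF bounded_bilinear_mink] continuous_intros)
  then have "open ((\<lambda>p. mink (p - q) (p - q)) -` (- {0}))"
    by (intro open_vimage) auto
  then show ?thesis
    by (simp add: light_cone_def vimage_def Compl_eq)
qed

lemma continuous_on_minv: "continuous_on (- light_cone q) (minv q b)"
  unfolding minv_def minversion_def
  by (intro bounded_bilinear.continuous_on[OF bounded_bilinear_mink] continuous_intros)
     (auto simp: light_cone_def)

lemma smooth_on_minv:
  assumes "open U" "smooth_on U f" "\<And>x. x \<in> U \<Longrightarrow> f x \<notin> light_cone q"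
  shows "smooth_on U (\<lambda>x. minv q b (f x))"
  unfolding smooth_on_def
proof
  fix k
  have *: "Ck_on k (\<lambda>x. f x + (- q)) U"
    using assms(1,2) by (intro Ck_on_add Ck_on_const) (auto simp: smooth_on_def)
  have "Ck_on k (\<lambda>x. b + inverse (mink (f x + (- q)) (f x + (- q))) *\<^sub>R (f x + (- q))) U"
    using assms(1,3)
    by (intro Ck_on_add Ck_on_const * Ck_on_inverse
        Ck_on_bilinear[OF bounded_bilinear_scaleR] Ck_on_bilinear[OF bounded_bilinear_mink])
       (auto simp: light_cone_def)
  then show "Ck_on k (\<lambda>x. minv q b (f x)) U"
    by (simp add: minv_def minversion_def inverse_eq_divide)
qed

lemma has_derivative_inverse_mink:
  assumes "(f has_derivative f') (at x)" "mink (f x - q) (f x - q) \<noteq> 0"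
  shows "((\<lambda>x. 1 / mink (f x - q) (f x - q)) has_derivative
          (\<lambda>w. - 2 * mink (f x - q) (f' w) / (mink (f x - q) (f x - q))\<^sup>2)) (at x)"
proof -
  have fq: "((\<lambda>x. f x - q) has_derivative f') (at x)"
    using has_derivative_diff[OF assms(1) has_derivative_const[of q]] by simp
  show ?thesis
    unfolding inverse_eq_divide[symmetric]
    by (rule has_derivative_eq_rhs[OF
          Deriv.has_derivative_inverse[OF assms(2) bounded_bilinear.FDERIV[OF bounded_bilinear_mink fq fq]]])
       (simp add: fun_eq_iff mink_commute[of "f' _"] divide_inverse power2_eq_square)
qed

lemma has_derivative_minv:
  assumes "(f has_derivative f') (at x)" "f x \<notin> light_cone q"
  shows "((\<lambda>x. minv q b (f x)) has_derivative
          (\<lambda>w. (1 / mink (f x - q) (f x - q)) *\<^sub>R mreflect (f x - q) (f' w))) (at x)"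
proof -
  define p where "p = f x - q"
  have nz: "mink p p \<noteq> 0"
    using assms(2) by (simp add: light_cone_def p_def)
  have fq: "((\<lambda>x. f x - q) has_derivative f') (at x)"
    using has_derivative_diff[OF assms(1) has_derivative_const[of q]] by simp
  have "((\<lambda>x. b + (1 / mink (f x - q) (f x - q)) *\<^sub>R (f x - q)) has_derivative
      (\<lambda>w. 0 + ((1 / mink p p) *\<^sub>R f' w + (- 2 * mink p (f' w) / (mink p p)\<^sup>2) *\<^sub>R p))) (at x)"
    unfolding p_def
    by (intro has_derivative_add has_derivative_const has_derivative_scaleR
        has_derivative_inverse_mink assms(1) fq nz[unfolded p_def])
  then show ?thesis
    unfolding p_def[symmetric] minv_def minversion_def
    by (rule has_derivative_eq_rhs)
       (simp add: fun_eq_iff mreflect_def algebra_simps power2_eq_square)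
qed

text \<open>This differentiates the formula of the preceding lemma once more. The vector field \<open>g\<close> is
  meant to be a partial derivative of \<open>f\<close>.\<close>

lemma has_derivative_minv_derivative:
  assumes f: "(f has_derivative f') (at x)" and g: "(g has_derivative g') (at x)"
    and nz: "f x \<notin> light_cone q"
  shows "((\<lambda>x. (1 / mink (f x - q) (f x - q)) *\<^sub>R mreflect (f x - q) (g x)) has_derivative
          (\<lambda>w. (1 / mink (f x - q) (f x - q)) *\<^sub>R mreflect (f x - q) (g' w)
             + inversion_d2 (f x - q) (g x) (f' w))) (at x)"
proof -
  define p where "p = f x - q"
  define c where "c = (\<lambda>x. 1 / mink (f x - q) (f x - q))"
  define c' where "c' = (\<lambda>w. - 2 * mink p (f' w) / (mink p p)\<^sup>2)"
  have a: "mink p p \<noteq> 0"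
    using nz by (simp add: light_cone_def p_def)
  have fq: "((\<lambda>x. f x - q) has_derivative f') (at x)"
    using has_derivative_diff[OF f has_derivative_const[of q]] by simp
  have c: "(c has_derivative c') (at x)"
    unfolding c_def c'_def p_def
    by (rule has_derivative_inverse_mink[OF f a[unfolded p_def]])
  have m: "((\<lambda>x. mink (f x - q) (g x)) has_derivative (\<lambda>w. mink p (g' w) + mink (f' w) (g x))) (at x)"
    unfolding p_def by (rule bounded_bilinear.FDERIV[OF bounded_bilinear_mink fq g])
  have "((\<lambda>x. c x *\<^sub>R g x - (2 * (c x * (c x * mink (f x - q) (g x)))) *\<^sub>R (f x - q)) has_derivative
     (\<lambda>w. (c x *\<^sub>R g' w + c' w *\<^sub>R g x)
        - ((2 * (c x * (c x * mink p (g x)))) *\<^sub>R f' w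
          + (2 * (c x * (c x * (mink p (g' w) + mink (f' w) (g x)) + c' w * mink p (g x))
                  + c' w * (c x * mink p (g x)))) *\<^sub>R p))) (at x)"
    unfolding p_def
    by (intro has_derivative_diff has_derivative_scaleR has_derivative_mult has_derivative_mult_right
        c g fq m[unfolded p_def])
  moreover have "(\<lambda>x. c x *\<^sub>R g x - (2 * (c x * (c x * mink (f x - q) (g x)))) *\<^sub>R (f x - q))
      = (\<lambda>x. (1 / mink (f x - q) (f x - q)) *\<^sub>R mreflect (f x - q) (g x))"
    by (simp add: fun_eq_iff c_def mreflect_def algebra_simps)
  moreover have "(c x *\<^sub>R g' w + c' w *\<^sub>R g x)
        - ((2 * (c x * (c x * mink p (g x)))) *\<^sub>R f' w
          + (2 * (c x * (c x * (mink p (g' w) + mink (f' w) (g x)) + c' w * mink p (g x))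
                  + c' w * (c x * mink p (g x)))) *\<^sub>R p)
      = (1 / mink p p) *\<^sub>R mreflect p (g' w) + inversion_d2 p (g x) (f' w)" for w
  proof -
    have cx: "c x = 1 / mink p p" by (simp add: c_def p_def)
    show ?thesis
      unfolding cx c'_def mreflect_def inversion_d2_def vec_eq_iff mink_commute[of "f' w" "g x"]
      by (simp add: divide_inverse algebra_simps power2_eq_square power3_eq_cube)
  qed
  ultimately show ?thesis
    unfolding p_def by simp
qed

section \<open>The fundamental forms and the equation of principal lines under inversion\<close>

lemma frechet_minv:
  assumes "f differentiable (at z)" "f z \<notin> light_cone q"
  shows "frechet_derivative (minv q b \<circ> f) (at z) w =
    (1 / mink (f z - q) (f z - q)) *\<^sub>R mreflect (f z - q) (frechet_derivative f (at z) w)"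
proof -
  have "((minv q b \<circ> f) has_derivative (\<lambda>w. (1 / mink (f z - q) (f z - q)) *\<^sub>R
      mreflect (f z - q) (frechet_derivative f (at z) w))) (at z)"
    using has_derivative_minv[OF assms(1)[unfolded frechet_derivative_works] assms(2)]
    by (simp add: o_def)
  from fun_cong[OF frechet_derivative_at[OF this], of w] show ?thesis by (rule sym)
qed

text \<open>The formula for the first derivative is needed on a neighbourhood of \<open>z\<close> in order to be
  differentiated, which is why the assumptions are made on an open set.\<close>

lemma frechet_frechet_minv:
  assumes "open U" "smooth_on U X" "\<And>z. z \<in> U \<Longrightarrow> X z \<notin> light_cone q" "z \<in> U"
  shows "frechet_derivative (\<lambda>z. frechet_derivative (minv q b \<circ> X) (at z) w) (at z) w' =
    (1 / mink (X z - q) (X z - q)) *\<^sub>R mreflect (X z - q)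
        (frechet_derivative (\<lambda>z. frechet_derivative X (at z) w) (at z) w')
    + inversion_d2 (X z - q) (frechet_derivative X (at z) w) (frechet_derivative X (at z) w')"
proof -
  have C2: "Ck_on (Suc (Suc 0)) X U"
    using assms(2) unfolding smooth_on_def by blast
  note D1 = Ck_on_SucD(1)[OF C2]
  note D2 = Ck_on_SucD(1)[OF Ck_on_SucD(2)[OF C2]]
  have "((\<lambda>z. frechet_derivative (minv q b \<circ> X) (at z) w) has_derivative
     (\<lambda>w'. (1 / mink (X z - q) (X z - q)) *\<^sub>R mreflect (X z - q)
        (frechet_derivative (\<lambda>z. frechet_derivative X (at z) w) (at z) w')
    + inversion_d2 (X z - q) (frechet_derivative X (at z) w) (frechet_derivative X (at z) w'))) (at z)"
  proof (rule has_derivative_transform_within_open[OF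
        has_derivative_minv_derivative[OF D1 D2] assms(1,4)])
    show "(1 / mink (X y - q) (X y - q)) *\<^sub>R mreflect (X y - q) (frechet_derivative X (at y) w)
        = frechet_derivative (minv q b \<circ> X) (at y) w" if "y \<in> U" for y
      using frechet_minv[of X y q b w] assms(3)[OF that] C2 that by simp
  qed (use assms(3,4) in auto)
  from fun_cong[OF frechet_derivative_at[OF this], of w'] show ?thesis by (rule sym)
qed

text \<open>The common factor is \<open>a\<^sup>-\<^sup>2\<close> from the first fundamental form times \<open>-a\<^sup>-\<^sup>3\<close> from the second, whose
  added multiple of the first form cancels. The factor \<open>-a\<^sup>-\<^sup>3\<close> consists of \<open>a\<^sup>-\<^sup>1\<close> from the differential and \<open>-a\<^sup>-\<^sup>2\<close> from the normal.\<close>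

lemma coeffs_minv:
  fixes X z q b
  assumes U: "open U" "smooth_on U X" "\<And>z. z \<in> U \<Longrightarrow> X z \<notin> light_cone q" "z \<in> U"
  defines "a \<equiv> mink (X z - q) (X z - q)"
  shows "coeff_L (minv q b \<circ> X) z = - coeff_L X z / a ^ 5"
    and "coeff_M (minv q b \<circ> X) z = - coeff_M X z / a ^ 5"
    and "coeff_N (minv q b \<circ> X) z = - coeff_N X z / a ^ 5"
proof -
  define p where "p = X z - q"
  define n where "n = normal_field X z"
  define Y where "Y = minv q b \<circ> X"
  have a: "a = mink p p" "a \<noteq> 0" "mink p p \<noteq> 0"
    using U(3,4) by (auto simp: a_def p_def light_cone_def)
  have "Ck_on (Suc 0) X U"
    using U(2) unfolding smooth_on_def by blast
  then have diff: "X differentiable (at z)"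
    using U(4) by simp
  have D: "d_u Y z = (1 / a) *\<^sub>R mreflect p (d_u X z)" "d_v Y z = (1 / a) *\<^sub>R mreflect p (d_v X z)"
    unfolding d_u_def d_v_def Y_def p_def a_def by (rule frechet_minv[OF diff U(3)[OF U(4)]])+
  have first: "ff_E Y z = ff_E X z / a\<^sup>2" "ff_F Y z = ff_F X z / a\<^sup>2" "ff_G Y z = ff_G X z / a\<^sup>2"
    unfolding ff_E_def ff_F_def ff_G_def D
    by (simp_all add: mink_simps mink_mreflect[OF a(3)] power2_eq_square)
  have normal: "normal_field Y z = (- 1 / a\<^sup>2) *\<^sub>R mreflect p n"
    unfolding normal_field_def D n_def
    by (simp add: mcross_scaleR mcross_mreflect[OF a(3)] power2_eq_square)
  have perp: "mink (d_u X z) n = 0" "mink (d_v X z) n = 0"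
    by (simp_all add: n_def normal_field_def)
  have second: "mink ((1 / a) *\<^sub>R mreflect p l + inversion_d2 p h k) ((- 1 / a\<^sup>2) *\<^sub>R mreflect p n)
      = - mink l n / a ^ 3 - 2 * mink p n / a ^ 4 * mink h k"
    if "mink h n = 0" "mink k n = 0" for l h k
    using a(2) unfolding mink_simps mink_mreflect[OF a(3)] mink_inversion_d2_mreflect[OF a(3) that]
      a(1)[symmetric]
    by (simp add: field_simps eval_nat_numeral)
  have sf: "sf_e Y (normal_field Y z) z = - sf_e X n z / a ^ 3 - 2 * mink p n / a ^ 4 * ff_E X z"
    "sf_f Y (normal_field Y z) z = - sf_f X n z / a ^ 3 - 2 * mink p n / a ^ 4 * ff_F X z"
    "sf_g Y (normal_field Y z) z = - sf_g X n z / a ^ 3 - 2 * mink p n / a ^ 4 * ff_G X z"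
  proof -
    have abs: "d_u = (\<lambda>X z. frechet_derivative X (at z) (1, 0))"
      "d_v = (\<lambda>X z. frechet_derivative X (at z) (0, 1))"
      by (simp_all add: d_u_def d_v_def fun_eq_iff)
    have DD: "d_u (d_u Y) z = (1 / a) *\<^sub>R mreflect p (d_u (d_u X) z) + inversion_d2 p (d_u X z) (d_u X z)"
      "d_v (d_u Y) z = (1 / a) *\<^sub>R mreflect p (d_v (d_u X) z) + inversion_d2 p (d_u X z) (d_v X z)"
      "d_v (d_v Y) z = (1 / a) *\<^sub>R mreflect p (d_v (d_v X) z) + inversion_d2 p (d_v X z) (d_v X z)"
      unfolding abs Y_def p_def a_def by (rule frechet_frechet_minv[OF U(1,2), where q = q, OF U(3,4)], assumption)+
    show "sf_e Y (normal_field Y z) z = - sf_e X n z / a ^ 3 - 2 * mink p n / a ^ 4 * ff_E X z"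
      "sf_f Y (normal_field Y z) z = - sf_f X n z / a ^ 3 - 2 * mink p n / a ^ 4 * ff_F X z"
      "sf_g Y (normal_field Y z) z = - sf_g X n z / a ^ 3 - 2 * mink p n / a ^ 4 * ff_G X z"
      unfolding sf_e_def sf_f_def sf_g_def ff_E_def ff_F_def ff_G_def DD normal
      by (rule second perp)+
  qed
  \<comment> \<open>A minor is unchanged when a multiple of one row is added to the other, so \<open>s\<close> drops out.\<close>
  have combine: "x / a\<^sup>2 * (- y / a ^ 3 - s * w) - w / a\<^sup>2 * (- v / a ^ 3 - s * x)
      = - (x * y - w * v) / a ^ 5" for x y v w s
    by (simp add: divide_inverse algebra_simps eval_nat_numeral)
  show "coeff_L (minv q b \<circ> X) z = - coeff_L X z / a ^ 5"
    "coeff_M (minv q b \<circ> X) z = - coeff_M X z / a ^ 5"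
    "coeff_N (minv q b \<circ> X) z = - coeff_N X z / a ^ 5"
    unfolding coeff_L_def coeff_M_def coeff_N_def Y_def[symmetric] first sf n_def[symmetric]
    by (rule combine)+
qed

section \<open>Inverted surfaces and curves\<close>

lemma Ck_on_subset: "Ck_on k f U \<Longrightarrow> V \<subseteq> U \<Longrightarrow> Ck_on k f V"
  by (induction k arbitrary: f) (auto intro: continuous_on_subset)

lemma smooth_on_subset: "smooth_on U f \<Longrightarrow> V \<subseteq> U \<Longrightarrow> smooth_on V f"
  unfolding smooth_on_def using Ck_on_subset by blast

lemma smooth_on_imp_continuous_on: "smooth_on U f \<Longrightarrow> continuous_on U f"
  unfolding smooth_on_def by (metis Ck_on.simps(1))

lemma smooth_on_imp_differentiable: "smooth_on U f \<Longrightarrow> x \<in> U \<Longrightarrow> f differentiable (at x)"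
  unfolding smooth_on_def by (metis Ck_on.simps(2))

lemma mreflect_eq_0:
  assumes "mink p p \<noteq> 0" "mreflect p h = 0"
  shows "h = 0"
  using mreflect_mreflect[OF assms(1), of h] unfolding assms(2)
  by (simp add: mreflect_def bounded_bilinear.zero_right[OF bounded_bilinear_mink])

lemma mreflect_scaleR: "mreflect p (c *\<^sub>R h) = c *\<^sub>R mreflect p h"
  by (simp add: mreflect_def mink_simps algebra_simps)

lemma homeomorphism_minv:
  assumes "T \<inter> light_cone q = {}"
  shows "homeomorphism T (minv q b ` T) (minv q b) (minv b q)"
proof (rule homeomorphismI)
  show "continuous_on T (minv q b)"
    using assms by (auto intro: continuous_on_subset[OF continuous_on_minv])
  show "continuous_on (minv q b ` T) (minv b q)"
    using assms minv_notin_light_cone by (blast intro: continuous_on_subset[OF continuous_on_minv])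
  have *: "minv b q (minv q b p) = p" if "p \<in> T" for p
    using assms that by (intro minv_minv) auto
  then show "minv b q ` minv q b ` T \<subseteq> T" "\<And>p. p \<in> T \<Longrightarrow> minv b q (minv q b p) = p"
    "\<And>y. y \<in> minv q b ` T \<Longrightarrow> minv q b (minv b q y) = y"
    by auto
qed simp

lemma local_parametrization_imp_inj_on: "local_parametrization S U X \<Longrightarrow> inj_on X U"
  unfolding local_parametrization_def homeomorphism_def by (metis inj_on_inverseI)

text \<open>The part of a surface off the light cone is open in it. This lemma and the next pass between
  the parametrizations of a surface and those of its open subsets.\<close>

lemma local_parametrization_restrict:
  assumes "local_parametrization S U X" "openin (top_of_set S) T"
  shows "local_parametrization T {z \<in> U. X z \<in> T} X"
proof -
  obtain Y where X: "open U" "smooth_on U X" "openin (top_of_set S) (X ` U)"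
      "homeomorphism U (X ` U) X Y" "\<forall>z\<in>U. inj (frechet_derivative X (at z))"
    using assms(1) unfolding local_parametrization_def by blast
  obtain W where W: "open W" "T = S \<inter> W"
    using assms(2) by (auto simp: openin_open)
  obtain V where V: "open V" "X ` U = S \<inter> V"
    using X(3) by (auto simp: openin_open)
  define U' where "U' = {z \<in> U. X z \<in> T}"
  have U'U: "U' \<subseteq> U"
    by (auto simp: U'_def)
  have inS: "X z \<in> S" if "z \<in> U" for z
    using openin_imp_subset[OF X(3)] that by blast
  then have "U' = U \<inter> X -` W"
    by (auto simp: U'_def W(2))
  then have "open U'"
    using continuous_open_preimage[OF smooth_on_imp_continuous_on[OF X(2)] X(1) W(1)] by simp
  moreover have "smooth_on U' X"
    by (rule smooth_on_subset[OF X(2) U'U])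
  moreover have "openin (top_of_set T) (X ` U')"
  proof -
    have "X ` U' = T \<inter> X ` U"
      by (auto simp: U'_def)
    also have "\<dots> = T \<inter> V"
      unfolding V(2) W(2) by blast
    finally show ?thesis
      using V(1) by (auto simp: openin_open)
  qed
  moreover have "\<exists>Y. homeomorphism U' (X ` U') X Y"
    using homeomorphism_of_subsets[OF X(4) U'U image_mono[OF U'U] refl] by blast
  moreover have "\<forall>z\<in>U'. inj (frechet_derivative X (at z))"
    using X(5) U'U by blast
  ultimately show ?thesis
    unfolding local_parametrization_def U'_def[symmetric] by (intro conjI)
qed

lemma local_parametrization_extend:
  assumes "local_parametrization T U X" "openin (top_of_set S) T"
  shows "local_parametrization S U X"
  using assms openin_trans unfolding local_parametrization_def by blast

text \<open>The inverted parametrization is still an immersion because its differential is the old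
  one followed by an invertible reflection.\<close>

lemma local_parametrization_minv:
  assumes "local_parametrization T U X" "T \<inter> light_cone q = {}"
  shows "local_parametrization (minv q b ` T) U (minv q b \<circ> X)"
proof -
  obtain Y where X: "open U" "smooth_on U X" "openin (top_of_set T) (X ` U)"
      "homeomorphism U (X ` U) X Y" "\<forall>z\<in>U. inj (frechet_derivative X (at z))"
    using assms(1) unfolding local_parametrization_def by blast
  have nz: "X z \<notin> light_cone q" if "z \<in> U" for z
    using that assms(2) openin_imp_subset[OF X(3)] by blast
  have "smooth_on U (minv q b \<circ> X)"
    using smooth_on_minv[OF X(1,2) nz] by (simp add: o_def)
  moreover have "openin (top_of_set (minv q b ` T)) ((minv q b \<circ> X) ` U)"
    using homeomorphism_imp_open_map[OF homeomorphism_minv[OF assms(2)] X(3)]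
    by (simp add: image_comp)
  moreover have "homeomorphism U ((minv q b \<circ> X) ` U) (minv q b \<circ> X) (Y \<circ> minv b q)"
  proof (rule homeomorphism_compose[OF X(4)])
    show "homeomorphism (X ` U) ((minv q b \<circ> X) ` U) (minv q b) (minv b q)"
    proof -
      have "X ` U \<inter> light_cone q = {}"
        using nz by blast
      from homeomorphism_minv[OF this, of b] show ?thesis
        by (simp only: image_comp)
    qed
  qed
  moreover have "inj (frechet_derivative (minv q b \<circ> X) (at z))" if "z \<in> U" for z
  proof (rule injI)
    fix v w
    let ?D = "frechet_derivative X (at z)"
    have p: "mink (X z - q) (X z - q) \<noteq> 0"
      using nz[OF that] by (simp add: light_cone_def)
    assume "frechet_derivative (minv q b \<circ> X) (at z) v = frechet_derivative (minv q b \<circ> X) (at z) w"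
    then have "mreflect (X z - q) (?D v) = mreflect (X z - q) (?D w)"
      using p frechet_minv[OF smooth_on_imp_differentiable[OF X(2) that] nz[OF that]] by simp
    then have "?D v = ?D w"
      using mreflect_mreflect[OF p] by metis
    then show "v = w"
      using X(5) that by (auto dest: injD)
  qed
  ultimately show ?thesis
    using X(1) unfolding local_parametrization_def by blast
qed

lemma openin_diff_light_cone: "openin (top_of_set S) (S - light_cone q)"
  using openin_open_Int[OF open_light_cone_compl, of S q] by (simp add: Diff_eq)

lemma regular_surface_minv:
  assumes "regular_surface S"
  shows "regular_surface (minv q b ` (S - light_cone q))"
  unfolding regular_surface_def
proof
  fix y assume "y \<in> minv q b ` (S - light_cone q)"
  then obtain p where p: "p \<in> S - light_cone q" "y = minv q b p" by blast
  then obtain U X where X: "local_parametrization S U X" "p \<in> X ` U"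
    using assms unfolding regular_surface_def by blast
  have "local_parametrization (minv q b ` (S - light_cone q))
      {z \<in> U. X z \<in> S - light_cone q} (minv q b \<circ> X)"
    by (intro local_parametrization_minv local_parametrization_restrict[OF X(1)]
        openin_diff_light_cone) auto
  moreover have "y \<in> (minv q b \<circ> X) ` {z \<in> U. X z \<in> S - light_cone q}"
    using p X(2) by auto
  ultimately show "\<exists>U X. local_parametrization (minv q b ` (S - light_cone q)) U X \<and> y \<in> X ` U"
    by (intro exI conjI)
qed

text \<open>Only the values on \<open>J\<close> are compared, so that inverting a curve twice may be taken to return
  the original curve, whatever the values outside \<open>J\<close>.\<close>

lemma smooth_curve_minv:
  assumes "smooth_curve J \<gamma>" "\<And>t. t \<in> J \<Longrightarrow> \<gamma> t \<notin> light_cone q"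
    and \<delta>: "\<And>t. t \<in> J \<Longrightarrow> \<delta> t = minv q b (\<gamma> t)"
  shows "smooth_curve J \<delta>"
proof -
  have J: "open J" "is_interval J" "J \<noteq> {}" "smooth_on J \<gamma>"
    and nz: "\<And>t. t \<in> J \<Longrightarrow> vector_derivative \<gamma> (at t) \<noteq> 0"
    using assms(1) unfolding smooth_curve_def by auto
  have "smooth_on J (\<lambda>t. minv q b (\<gamma> t))"
    by (rule smooth_on_minv[OF J(1,4) assms(2)])
  then have "smooth_on J \<delta>"
    unfolding smooth_on_def by (auto intro: Ck_on_cong[OF _ J(1)] simp: \<delta>)
  moreover have "vector_derivative \<delta> (at t) \<noteq> 0" if "t \<in> J" for t
  proof -
    define p where "p = \<gamma> t - q"
    let ?v = "vector_derivative \<gamma> (at t)"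
    have p: "mink p p \<noteq> 0"
      using assms(2)[OF that] by (simp add: light_cone_def p_def)
    have "(\<gamma> has_derivative (\<lambda>x. x *\<^sub>R ?v)) (at t)"
      using smooth_on_imp_differentiable[OF J(4) that]
      by (simp add: vector_derivative_works has_vector_derivative_def)
    from has_derivative_minv[OF this assms(2)[OF that], where b = b]
    have "((\<lambda>t. minv q b (\<gamma> t)) has_vector_derivative (1 / mink p p) *\<^sub>R mreflect p ?v) (at t)"
      by (simp add: has_vector_derivative_def mreflect_scaleR p_def mult.commute)
    then have "(\<delta> has_vector_derivative (1 / mink p p) *\<^sub>R mreflect p ?v) (at t)"
      by (rule has_vector_derivative_transform_within_open[OF _ J(1) that]) (simp add: \<delta>)
    then have "vector_derivative \<delta> (at t) = (1 / mink p p) *\<^sub>R mreflect p ?v"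
      by (rule vector_derivative_at)
    then show ?thesis
      using p nz[OF that] mreflect_eq_0[OF p] by auto
  qed
  ultimately show ?thesis
    using J unfolding smooth_curve_def by blast
qed

text \<open>The target \<open>T\<close> may be larger than the inverted surface. Taken equal to it,
  it gives the passage from \<open>S\<close> to the inverted surface. The larger target serves the passage back, since
  the inverse map returns only the part of \<open>S\<close> off the light cone.

  A parametrization \<open>Y\<close> of \<open>T\<close>, restricted and pulled back to \<open>S\<close>, gives a parametrization \<open>X\<close> in which \<open>\<gamma>\<close> has
  the same coordinates as \<open>\<delta>\<close> has in \<open>Y\<close>. The coefficients in \<open>X\<close> and \<open>Y\<close> are proportional.\<close>

lemma principal_line_minv:
  assumes \<gamma>: "principal_line S J \<gamma>" "\<gamma> ` J \<subseteq> S - light_cone q"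
    and T: "openin (top_of_set T) (minv q b ` (S - light_cone q))"
    and \<delta>: "\<And>t. t \<in> J \<Longrightarrow> \<delta> t = minv q b (\<gamma> t)"
  shows "principal_line T J \<delta>"
proof -
  let ?S = "S - light_cone q" and ?T = "minv q b ` (S - light_cone q)"
  have nlc: "\<gamma> t \<notin> light_cone q" if "t \<in> J" for t
    using \<gamma>(2) that by blast
  have curve: "smooth_curve J \<gamma>"
    using \<gamma>(1) unfolding principal_line_def by blast
  then have J: "open J" unfolding smooth_curve_def by blast
  have \<delta>curve: "smooth_curve J \<delta>"
    by (rule smooth_curve_minv[OF curve nlc \<delta>])
  then have \<delta>cont: "continuous_on J \<delta>"
    unfolding smooth_curve_def by (blast intro: smooth_on_imp_continuous_on)
  have \<delta>T: "\<delta> t \<in> ?T" if "t \<in> J" for t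
    using \<gamma>(2) \<delta> that by auto
  then have \<delta>JT: "\<delta> ` J \<subseteq> T"
    using openin_imp_subset[OF T] by blast
  have Tlc: "?T \<inter> light_cone b = {}"
    using minv_notin_light_cone by blast
  have inverse_image: "minv b q ` ?T = ?S"
    using homeomorphism_image2[OF homeomorphism_minv[of ?S q b]] by blast
  have "principal_equation Y (inv_into V Y (\<delta> t))
            (vector_derivative (\<lambda>s. inv_into V Y (\<delta> s)) (at t)) \<and>
          \<not> umbilic Y (inv_into V Y (\<delta> t))"
    if Y: "local_parametrization T V Y" and t: "t \<in> J" "\<delta> t \<in> Y ` V" for V Y t
  proof -
    define U where "U = {z \<in> V. Y z \<in> ?T}"
    define X where "X = minv b q \<circ> Y"
    have YT: "local_parametrization ?T U Y"
      unfolding U_def by (rule local_parametrization_restrict[OF Y T])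
    have "local_parametrization (minv b q ` ?T) U X"
      unfolding X_def by (rule local_parametrization_minv[OF YT Tlc])
    then have X: "local_parametrization S U X"
      unfolding inverse_image by (rule local_parametrization_extend[OF _ openin_diff_light_cone])
    have injY: "inj_on Y V" and injX: "inj_on X U"
      using local_parametrization_imp_inj_on Y X by blast+
    have coords: "inv_into V Y (\<delta> s) \<in> U \<and> inv_into V Y (\<delta> s) = inv_into U X (\<gamma> s) \<and> \<gamma> s \<in> X ` U"
      if s: "s \<in> J" "\<delta> s \<in> Y ` V" for s
    proof -
      obtain z where z: "z \<in> V" "\<delta> s = Y z" using s(2) by blast
      have zU: "z \<in> U"
        using z \<delta>T[OF s(1)] by (simp add: U_def)
      have "\<gamma> s = X z"
        unfolding X_def o_def z(2)[symmetric] \<delta>[OF s(1)] by (rule minv_minv[OF nlc[OF s(1)], symmetric])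
      then show ?thesis
        using z zU by (simp add: inv_into_f_f[OF injY] inv_into_f_f[OF injX])
    qed
    define z where "z = inv_into U X (\<gamma> t)"
    have z: "z \<in> U" "inv_into V Y (\<delta> t) = z" "\<gamma> t \<in> X ` U"
      using coords[OF t] by (auto simp: z_def)
    \<comment> \<open>The coordinate curves agree only while \<open>\<delta>\<close> stays in the image of \<open>Y\<close>; to compare the velocities
      this must hold on a neighbourhood of \<open>t\<close>.\<close>
    have "open (J \<inter> \<delta> -` (Y ` V))"
    proof -
      have "openin (top_of_set T) (Y ` V)"
        using Y unfolding local_parametrization_def by blast
      then have "openin (top_of_set J) (J \<inter> \<delta> -` (Y ` V))"
        using continuous_openin_preimage[OF \<delta>cont _] \<delta>JT by blast
      then show ?thesis
        using J openin_open_eq by blast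
    qed
    then have "eventually (\<lambda>s. s \<in> J \<inter> \<delta> -` (Y ` V)) (nhds t)"
      using t by (intro eventually_nhds_in_open) auto
    then have "eventually (\<lambda>s. inv_into V Y (\<delta> s) = inv_into U X (\<gamma> s)) (nhds t)"
      by (rule eventually_mono) (use coords in auto)
    then have velocity: "vector_derivative (\<lambda>s. inv_into V Y (\<delta> s)) (at t) =
        vector_derivative (\<lambda>s. inv_into U X (\<gamma> s)) (at t)"
      by (intro vector_derivative_cong_eq) (auto elim: eventually_mono)
    have principal: "principal_equation X z (vector_derivative (\<lambda>s. inv_into U X (\<gamma> s)) (at t))"
        "\<not> umbilic X z"
      using \<gamma>(1) X t(1) z(3) unfolding principal_line_def z_def by blast+
    have U: "open U" "smooth_on U Y"
      using YT unfolding local_parametrization_def by blast+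
    have Ulc: "Y z \<notin> light_cone b" if "z \<in> U" for z
      using that Tlc by (auto simp: U_def)
    define k where "k = - 1 / mink (Y z - b) (Y z - b) ^ 5"
    have k: "k \<noteq> 0"
      using Ulc[OF z(1)] by (simp add: k_def light_cone_def)
    have coeffs: "coeff_L X z = k * coeff_L Y z" "coeff_M X z = k * coeff_M Y z"
        "coeff_N X z = k * coeff_N Y z"
      using coeffs_minv[OF U Ulc z(1), where b = q] unfolding X_def k_def by simp_all
    have "umbilic X z \<longleftrightarrow> umbilic Y z"
      using k by (simp add: umbilic_def coeffs)
    moreover have "principal_equation X z w \<longleftrightarrow> principal_equation Y z w" for w
    proof (cases w)
      case (Pair du dv)
      have "coeff_L X z * dv\<^sup>2 + coeff_M X z * du * dv + coeff_N X z * du\<^sup>2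
          = k * (coeff_L Y z * dv\<^sup>2 + coeff_M Y z * du * dv + coeff_N Y z * du\<^sup>2)"
        by (simp add: coeffs algebra_simps)
      then show ?thesis
        using k by (simp add: principal_equation_def Pair)
    qed
    ultimately show ?thesis
      using principal unfolding z(2) velocity by simp
  qed
  then show ?thesis
    using \<delta>curve \<delta>JT unfolding principal_line_def by blast
qed

section \<open>Principal lines correspond under inversion\<close>

theorem proposition5p1:
  fixes S :: "(real^3) set" and q :: "real^3"
  assumes "regular_surface S" and "q \<notin> S"
  shows "regular_surface (minversion q ` (S - light_cone q)) \<and>
    (\<forall>J \<gamma>. \<gamma> ` J \<subseteq> S - light_cone q \<longrightarrow>
      (principal_line S J \<gamma> \<longleftrightarrow>
       principal_line (minversion q ` (S - light_cone q)) J (minversion q \<circ> \<gamma>)))"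
proof (intro conjI allI impI)
  let ?S = "S - light_cone q"
  let ?T = "minversion q ` ?S"
  show "regular_surface ?T"
    using regular_surface_minv[OF assms(1), of q 0] by (simp add: minv_0)
  fix J and \<gamma> :: "real \<Rightarrow> real^3"
  assume \<gamma>: "\<gamma> ` J \<subseteq> ?S"
  have T_off: "?T - light_cone 0 = ?T"
    using minv_notin_light_cone[of _ q 0] by (auto simp: minv_0)
  show "principal_line S J \<gamma> \<longleftrightarrow> principal_line ?T J (minversion q \<circ> \<gamma>)"
  proof
    assume "principal_line S J \<gamma>"
    then show "principal_line ?T J (minversion q \<circ> \<gamma>)"
      by (rule principal_line_minv[where b = 0, OF _ \<gamma>]) (simp_all add: minv_0)
  next
    assume line: "principal_line ?T J (minversion q \<circ> \<gamma>)"
    show "principal_line S J \<gamma>"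
    proof (rule principal_line_minv[OF line])
      show "(minversion q \<circ> \<gamma>) ` J \<subseteq> ?T - light_cone 0"
        using \<gamma> unfolding T_off by auto
      have "minv 0 q ` ?T = ?S"
        using homeomorphism_image2[OF homeomorphism_minv[of ?S q 0]] by (auto simp: minv_0)
      then show "openin (top_of_set S) (minv 0 q ` (?T - light_cone 0))"
        by (simp add: T_off openin_diff_light_cone)
      show "\<gamma> t = minv 0 q ((minversion q \<circ> \<gamma>) t)" if "t \<in> J" for t
        using minv_minv[of "\<gamma> t" q 0] \<gamma> that by (auto simp: minv_0)
    qed
  qed
qed

end
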